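(* Let $M$ be a proper pointed metric space and let $X$ be a real Banach space. Then $S(M,X)$ is linearly isometrically isomorphic to $K_{w^*,w}(X^*,S(M))$.
   Context: All Banach spaces are real. A pointed metric space is a metric space $(M,d)$ with a designated origin $0\in M$; it is proper if all closed balls are compact. $B(x,r)$ is the open ball. For a Banach space $X$, $Lip(M,X)$ is the Banach space of Lipschitz functions $f:M\to X$ with $f(0)=0$, with norm $\|f\|=\sup_{x\neq y}\frac{\|f(x)-f(y)\|}{d(x,y)}$. $lip(M,X)$ is the subspace of those $f\in Lip(M,X)$ with $\lim_{\varepsilon\to0}\sup_{0<d(x,y)<\varepsilon}\frac{\|f(x)-f(y)\|}{d(x,y)}=0$. $S(M,X)$ is the subspace of those $f\in lip(M,X)$ with $\lim_{r\to\infty}\sup\left\{\frac{\|f(x)-f(y)\|}{d(x,y)}: x\ne y,\ x\notin B(0,r)\text{ or }y\notin B(0,r)\right\}=0$. Suprema over empty sets are $0$. $S(M)=S(M,\mathbb R)$. $K_{w^*,w}(X^*,S(M))$ is the space, with the operator norm, of compact linear operators $T:X^*\to S(M)$ that are continuous from the weak-star topology of $X^*$ to the weak topology of $S(M)$. *)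

theory Defs
  imports "HOL-Analysis.Analysis"
begin

section \<open>Pointed metric spaces\<close>

class pointed_metric_space = metric_space +
  fixes origin :: 'a

text \<open>The library class \<open>heine_borel\<close> bundles a closely related property into the type;
  here properness is a proposition about the type, so that it can be a hypothesis.\<close>

definition proper_metric :: "'m::metric_space itself \<Rightarrow> bool" where
  "proper_metric _ \<longleftrightarrow> (\<forall>(x::'m) r. compact (cball x r))"

section \<open>Lipschitz functions\<close>

text \<open>Supremum of the difference quotients over the pairs of distinct points that satisfy \<open>P\<close>.
  All quotients are nonnegative, so inserting \<open>0\<close> only fixes the value for an empty set of pairs.
  The real supremum is meaningful only for sets bounded above; below it is only used for
  Lipschitz \<open>f\<close>.\<close>

definition slope_sup ::
    "('m::metric_space \<Rightarrow> 'x::real_normed_vector) \<Rightarrow> ('m \<Rightarrow> 'm \<Rightarrow> bool) \<Rightarrow> real" where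
  "slope_sup f P = Sup (insert 0 {norm (f x - f y) / dist x y | x y. x \<noteq> y \<and> P x y})"

definition Lip :: "('m::pointed_metric_space \<Rightarrow> 'x::real_normed_vector) set" where
  "Lip = {f. f origin = 0 \<and> (\<exists>C. C-lipschitz_on UNIV f)}"

definition Lip_norm :: "('m::pointed_metric_space \<Rightarrow> 'x::real_normed_vector) \<Rightarrow> real" where
  "Lip_norm f = slope_sup f (\<lambda>x y. True)"

definition little_lip :: "('m::pointed_metric_space \<Rightarrow> 'x::real_normed_vector) set" where
  "little_lip = {f \<in> Lip. ((\<lambda>\<epsilon>. slope_sup f (\<lambda>x y. dist x y < \<epsilon>)) \<longlongrightarrow> 0) (at_right 0)}"

definition S_set :: "('m::pointed_metric_space \<Rightarrow> 'x::real_normed_vector) set" where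
  "S_set = {f \<in> little_lip.
     ((\<lambda>r. slope_sup f (\<lambda>x y. x \<notin> ball origin r \<or> y \<notin> ball origin r)) \<longlongrightarrow> 0) at_top}"

lemma slope_le:
  assumes "C-lipschitz_on UNIV f" "x \<noteq> y"
  shows "norm (f x - f y) / dist x y \<le> C"
  using lipschitz_onD[OF assms(1), of x y] assms(2)
  by (simp add: divide_le_eq dist_norm)

lemma slope_bdd:
  assumes "f \<in> Lip"
  shows "bdd_above (insert 0 {norm (f x - f y) / dist x y | x y. x \<noteq> y \<and> P x y})"
proof -
  obtain C where C: "C-lipschitz_on UNIV f"
    using assms by (auto simp: Lip_def)
  show ?thesis
    by (rule bdd_aboveI[of _ C]) (auto intro: slope_le[OF C] lipschitz_on_nonneg[OF C])
qed

lemma slope_sup_upper: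
  assumes "f \<in> Lip" "x \<noteq> y" "P x y"
  shows "norm (f x - f y) / dist x y \<le> slope_sup f P"
  unfolding slope_sup_def using assms by (intro cSup_upper slope_bdd) auto

lemma slope_sup_nonneg:
  assumes "f \<in> Lip"
  shows "0 \<le> slope_sup f P"
  unfolding slope_sup_def using assms by (intro cSup_upper slope_bdd) auto

lemma slope_sup_least:
  assumes "0 \<le> c" "\<And>x y. x \<noteq> y \<Longrightarrow> P x y \<Longrightarrow> norm (f x - f y) / dist x y \<le> c"
  shows "slope_sup f P \<le> c"
  unfolding slope_sup_def using assms by (intro cSup_least) auto

lemma Lip_zero: "(\<lambda>_. 0) \<in> Lip"
  by (auto simp: Lip_def intro!: exI[of _ 0] lipschitz_on_constant)

lemma Lip_add:
  assumes "f \<in> Lip" "g \<in> Lip"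
  shows "(\<lambda>x. f x + g x) \<in> Lip"
  using assms by (auto simp: Lip_def intro: lipschitz_on_add)

lemma Lip_scaleR:
  assumes "f \<in> Lip"
  shows "(\<lambda>x. c *\<^sub>R f x) \<in> Lip"
  using assms by (auto simp: Lip_def intro: lipschitz_on_cmult)

lemma slope_sup_zero:
  "slope_sup (\<lambda>_ :: 'a::metric_space. 0 :: 'b::real_normed_vector) P = 0"
proof -
  have *: "insert 0 {norm (0 - 0 :: 'b) / dist x y | x y :: 'a. x \<noteq> y \<and> P x y} = {0}"
    by auto
  show ?thesis
    unfolding slope_sup_def * by simp
qed

lemma slope_sup_add:
  assumes "f \<in> Lip" "g \<in> Lip"
  shows "slope_sup (\<lambda>x. f x + g x) P \<le> slope_sup f P + slope_sup g P"
proof (rule slope_sup_least)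
  show "0 \<le> slope_sup f P + slope_sup g P"
    using assms by (simp add: slope_sup_nonneg)
  fix x y :: 'a assume xy: "x \<noteq> y" "P x y"
  have "norm (f x + g x - (f y + g y)) \<le> norm (f x - f y) + norm (g x - g y)"
    by (metis add_diff_add norm_triangle_ineq)
  then have "norm (f x + g x - (f y + g y)) / dist x y
      \<le> norm (f x - f y) / dist x y + norm (g x - g y) / dist x y"
    by (simp add: add_divide_distrib[symmetric] divide_right_mono)
  also have "\<dots> \<le> slope_sup f P + slope_sup g P"
    using assms xy by (intro add_mono slope_sup_upper)
  finally show "norm (f x + g x - (f y + g y)) / dist x y \<le> slope_sup f P + slope_sup g P" .
qed

lemma slope_sup_scaleR_le:
  assumes "f \<in> Lip"
  shows "slope_sup (\<lambda>x. c *\<^sub>R f x) P \<le> \<bar>c\<bar> * slope_sup f P"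
proof (rule slope_sup_least)
  show "0 \<le> \<bar>c\<bar> * slope_sup f P"
    using assms by (simp add: slope_sup_nonneg)
  fix x y :: 'a assume xy: "x \<noteq> y" "P x y"
  have "norm (c *\<^sub>R f x - c *\<^sub>R f y) / dist x y = \<bar>c\<bar> * (norm (f x - f y) / dist x y)"
    by (simp flip: scaleR_diff_right)
  also have "\<dots> \<le> \<bar>c\<bar> * slope_sup f P"
    using assms xy by (intro mult_left_mono slope_sup_upper) auto
  finally show "norm (c *\<^sub>R f x - c *\<^sub>R f y) / dist x y \<le> \<bar>c\<bar> * slope_sup f P" .
qed

lemma slope_sup_scaleR:
  assumes "f \<in> Lip"
  shows "slope_sup (\<lambda>x. c *\<^sub>R f x) P = \<bar>c\<bar> * slope_sup f P"
proof (cases "c = 0")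
  case True
  then show ?thesis by (simp add: slope_sup_zero)
next
  case False
  have "slope_sup f P \<le> \<bar>inverse c\<bar> * slope_sup (\<lambda>x. c *\<^sub>R f x) P"
    using slope_sup_scaleR_le[OF Lip_scaleR[OF assms, of c], of "inverse c" P] False by simp
  with False have "\<bar>c\<bar> * slope_sup f P \<le> slope_sup (\<lambda>x. c *\<^sub>R f x) P"
    by (simp add: field_simps abs_inverse)
  with slope_sup_scaleR_le[OF assms, of c P] show ?thesis by simp
qed

lemma slope_sup_tendsto_add:
  assumes "f \<in> Lip" "g \<in> Lip"
    and "((\<lambda>e. slope_sup f (P e)) \<longlongrightarrow> 0) F" "((\<lambda>e. slope_sup g (P e)) \<longlongrightarrow> 0) F"
  shows "((\<lambda>e. slope_sup (\<lambda>x. f x + g x) (P e)) \<longlongrightarrow> 0) F"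
proof (rule tendsto_sandwich[OF _ _ tendsto_const])
  show "\<forall>\<^sub>F e in F. 0 \<le> slope_sup (\<lambda>x. f x + g x) (P e)"
    using assms by (simp add: slope_sup_nonneg Lip_add)
  show "\<forall>\<^sub>F e in F. slope_sup (\<lambda>x. f x + g x) (P e) \<le> slope_sup f (P e) + slope_sup g (P e)"
    using assms by (simp add: slope_sup_add)
  show "((\<lambda>e. slope_sup f (P e) + slope_sup g (P e)) \<longlongrightarrow> 0) F"
    using tendsto_add[OF assms(3,4)] by simp
qed

lemma S_set_Lip: "f \<in> S_set \<Longrightarrow> f \<in> Lip"
  by (simp add: S_set_def little_lip_def)

lemma S_set_zero: "(\<lambda>_. 0) \<in> S_set"
  by (simp add: S_set_def little_lip_def Lip_zero slope_sup_zero)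

lemma S_set_add:
  assumes "f \<in> S_set" "g \<in> S_set"
  shows "(\<lambda>x. f x + g x) \<in> S_set"
  using assms
  by (auto simp: S_set_def little_lip_def intro: Lip_add slope_sup_tendsto_add)

lemma S_set_scaleR:
  assumes "f \<in> S_set"
  shows "(\<lambda>x. c *\<^sub>R f x) \<in> S_set"
  using assms
  by (auto simp: S_set_def little_lip_def slope_sup_scaleR intro: Lip_scaleR tendsto_mult_right_zero)

section \<open>The normed space \<open>S(M,X)\<close>\<close>

typedef (overloaded) ('m::pointed_metric_space, 'x::real_normed_vector) S =
  "S_set :: ('m \<Rightarrow> 'x) set"
  morphisms S_apply Abs_S
  using S_set_zero by blast

setup_lifting type_definition_S

instantiation S :: (pointed_metric_space, real_normed_vector) real_normed_vector
begin

lift_definition zero_S :: "('a, 'b) S" is "\<lambda>_. 0"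
  by (rule S_set_zero)

lift_definition plus_S :: "('a, 'b) S \<Rightarrow> ('a, 'b) S \<Rightarrow> ('a, 'b) S" is "\<lambda>f g x. f x + g x"
  by (rule S_set_add)

lift_definition scaleR_S :: "real \<Rightarrow> ('a, 'b) S \<Rightarrow> ('a, 'b) S" is "\<lambda>c f x. c *\<^sub>R f x"
  by (rule S_set_scaleR)

lift_definition uminus_S :: "('a, 'b) S \<Rightarrow> ('a, 'b) S" is "\<lambda>f x. - f x"
  using S_set_scaleR[of _ "-1"] by simp

lift_definition minus_S :: "('a, 'b) S \<Rightarrow> ('a, 'b) S \<Rightarrow> ('a, 'b) S" is "\<lambda>f g x. f x - g x"
  using S_set_add[OF _ S_set_scaleR[of _ "-1"]] by simp

lift_definition norm_S :: "('a, 'b) S \<Rightarrow> real" is Lip_norm .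

definition sgn_S :: "('a, 'b) S \<Rightarrow> ('a, 'b) S" where
  "sgn_S f = inverse (norm f) *\<^sub>R f"

definition dist_S :: "('a, 'b) S \<Rightarrow> ('a, 'b) S \<Rightarrow> real" where
  "dist_S f g = norm (f - g)"

definition uniformity_S :: "(('a, 'b) S \<times> ('a, 'b) S) filter" where
  "uniformity_S = (INF e\<in>{0<..}. principal {(f, g). dist f g < e})"

definition open_S :: "('a, 'b) S set \<Rightarrow> bool" where
  "open_S U \<longleftrightarrow> (\<forall>f\<in>U. \<forall>\<^sub>F (f', g) in uniformity. f' = f \<longrightarrow> g \<in> U)"

instance
proof
  fix f g h :: "('a, 'b) S" and a b :: real
  show "f + g + h = f + (g + h)" by transfer (simp add: add.assoc)
  show "f + g = g + f" by transfer (simp add: add.commute)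
  show "0 + f = f" by transfer simp
  show "- f + f = 0" by transfer simp
  show "f - g = f + - g" by transfer simp
  show "a *\<^sub>R (f + g) = a *\<^sub>R f + a *\<^sub>R g" by transfer (simp add: scaleR_add_right)
  show "(a + b) *\<^sub>R f = a *\<^sub>R f + b *\<^sub>R f" by transfer (simp add: scaleR_add_left)
  show "a *\<^sub>R b *\<^sub>R f = (a * b) *\<^sub>R f" by transfer simp
  show "1 *\<^sub>R f = f" by transfer simp
  show "sgn f = inverse (norm f) *\<^sub>R f" by (rule sgn_S_def)
  show "dist f g = norm (f - g)" by (rule dist_S_def)
  show "(uniformity :: (('a, 'b) S \<times> ('a, 'b) S) filter)
      = (INF e\<in>{0<..}. principal {(f, g). dist f g < e})" by (rule uniformity_S_def)
  show "open U \<longleftrightarrow> (\<forall>f\<in>U. \<forall>\<^sub>F (f', g) in uniformity. f' = f \<longrightarrow> g \<in> U)"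
    for U :: "('a, 'b) S set" by (rule open_S_def)
  show "norm (f + g) \<le> norm f + norm g"
    by transfer (simp add: Lip_norm_def slope_sup_add S_set_Lip)
  show "norm (a *\<^sub>R f) = \<bar>a\<bar> * norm f"
    by transfer (simp add: Lip_norm_def slope_sup_scaleR S_set_Lip)
  show "norm f = 0 \<longleftrightarrow> f = 0"
  proof transfer
    fix f :: "'a \<Rightarrow> 'b" assume f: "f \<in> S_set"
    show "Lip_norm f = 0 \<longleftrightarrow> f = (\<lambda>_. 0)"
    proof
      assume *: "Lip_norm f = 0"
      have "f x = 0" for x
      proof (cases "x = origin")
        case True
        then show ?thesis using S_set_Lip[OF f] by (simp add: Lip_def)
      next
        case False
        have "norm (f x - f origin) / dist x origin \<le> 0"
          using slope_sup_upper[OF S_set_Lip[OF f] False, of "\<lambda>x y. True"] *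
          by (simp add: Lip_norm_def)
        then show ?thesis
          using False S_set_Lip[OF f] by (simp add: Lip_def divide_le_0_iff)
      qed
      then show "f = (\<lambda>_. 0)" by auto
    qed (simp add: Lip_norm_def slope_sup_zero)
  qed
qed

end

section \<open>Compact weak-star to weak continuous operators\<close>

text \<open>On the dual \<open>'x \<Rightarrow>\<^sub>L real\<close> the library's strong operator topology, i.e. the topology of
  pointwise convergence on \<open>'x\<close>, is by definition the weak-star topology.\<close>

abbreviation weak_star_topology :: "('x::real_normed_vector \<Rightarrow>\<^sub>L real) topology" where
  "weak_star_topology \<equiv> strong_operator_topology"

text \<open>The initial topology with respect to all bounded linear functionals; \<open>euclidean\<close> is the
  product topology on the function space.\<close>

definition weak_topology :: "'y::real_normed_vector topology" where
  "weak_topology =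
     pullback_topology UNIV (\<lambda>y (\<phi> :: 'y \<Rightarrow>\<^sub>L real). blinfun_apply \<phi> y) euclidean"

definition compact_operator ::
    "('x::real_normed_vector \<Rightarrow>\<^sub>L 'y::real_normed_vector) \<Rightarrow> bool" where
  "compact_operator T \<longleftrightarrow> compact (closure (blinfun_apply T ` cball 0 1))"

text \<open>Compact linear operators are bounded, so nothing is lost by working inside the type of
  bounded operators, whose norm is the operator norm.\<close>

definition K_wstar_w ::
    "(('x::real_normed_vector \<Rightarrow>\<^sub>L real) \<Rightarrow>\<^sub>L 'y::real_normed_vector) set" where
  "K_wstar_w = {T. compact_operator T \<and>
     continuous_map weak_star_topology weak_topology (blinfun_apply T)}"

end

theory Submission
  imports Defs
begin

text \<open>The isomorphism sends \<open>f \<in> S(M,X)\<close> to the operator \<open>\<phi> \<mapsto> \<phi> \<circ> f\<close> (\<open>dual_operator\<close>). It is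
  isometric because, by Hahn--Banach, the norm of \<open>f x - f y\<close> is the supremum of
  \<open>\<phi> (f x - f y)\<close> over the dual ball.

  \<^emph>\<open>The operator is compact and weak-star to weak continuous.\<close> Since \<open>M\<close> is proper, the difference
  quotients of \<open>f\<close> form a totally bounded set in \<open>X\<close>: those that are not uniformly small come from
  a compact set of pairs (\<open>slopes_totally_bounded\<close>). Hence for every \<open>e > 0\<close> there is a finite
  \<open>K \<subseteq> X\<close> such that the norm of \<open>\<phi> \<circ> f\<close> is at most the maximum of \<open>\<bar>\<phi> k\<bar>\<close> over \<open>K\<close>
  plus \<open>e * norm \<phi>\<close> (\<open>dual_operator_finitely_controlled\<close>). So the operator is weak-star to norm
  continuous on the dual ball, which is weak-star compact, and compactness follows. For a functional
  \<open>\<psi>\<close> on \<open>S(M)\<close>, the composite \<open>\<phi> \<mapsto> \<psi> (\<phi> \<circ> f)\<close> has norm at most \<open>e * norm \<psi>\<close> on the annihilator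
  of \<open>K\<close>; as \<open>X\<close> is complete, such a functional is the evaluation at a point of \<open>X\<close>
  (\<open>approximable_functional_is_evaluation\<close>), hence weak-star continuous.

  \<^emph>\<open>Every operator arises.\<close> Given \<open>T\<close>, the functional \<open>\<phi> \<mapsto> T \<phi> x\<close> is weak-star continuous
  and so is the evaluation at a unique \<open>f x \<in> X\<close>. Relatively compact sets in \<open>S(M)\<close> have uniformly
  decaying difference quotients, because finite sets have; applied to the image of the dual ball
  this shows \<open>f \<in> S(M,X)\<close> (\<open>dual_operator_surj\<close>).\<close>

section \<open>Hahn--Banach extension\<close>

text \<open>A partially defined functional is represented by its graph, a subspace of
  \<open>'a \<times> real\<close>. A dominated graph is single-valued: if \<open>(0, a)\<close> belongs to it, then so
  does \<open>(0, - a)\<close>, whence \<open>a \<le> 0\<close> and \<open>- a \<le> 0\<close>. Unions of chains and one-step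
  extensions are then plain unions and spans.

  The value \<open>c\<close> at the new vector \<open>x0\<close> must satisfy
  \<open>a - p (x - x0) \<le> c \<le> p (y + x0) - b\<close> for all \<open>(x, a)\<close> and \<open>(y, b)\<close> in the graph, and
  subadditivity says that every such lower bound is below every such upper bound.\<close>
lemma dominated_graph_extend:
  fixes G :: "('a::real_vector \<times> real) set" and p :: "'a \<Rightarrow> real"
  assumes p_add: "\<And>x y. p (x + y) \<le> p x + p y"
    and p_scale: "\<And>t x. 0 \<le> t \<Longrightarrow> p (t *\<^sub>R x) = t * p x"
    and G: "subspace G" and dom: "\<And>x a. (x, a) \<in> G \<Longrightarrow> a \<le> p x"
  obtains c where "\<And>x a. (x, a) \<in> span (insert (x0, c) G) \<Longrightarrow> a \<le> p x"
proof -
  have cross: "a - p (x - x0) \<le> p (y + x0) - b" if "(x, a) \<in> G" "(y, b) \<in> G" for x a y b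
  proof -
    have "(x + y, a + b) \<in> G"
      using subspace_add[OF G that] by simp
    then have "a + b \<le> p ((x - x0) + (y + x0))"
      using dom by simp
    also have "\<dots> \<le> p (x - x0) + p (y + x0)"
      by (rule p_add)
    finally show ?thesis by simp
  qed
  have zero: "(0, 0) \<in> G"
    using subspace_0[OF G] by (simp add: zero_prod_def)
  \<comment> \<open>the least admissible value\<close>
  define c where "c = Sup ((\<lambda>(x, a). a - p (x - x0)) ` G)"
  have lower: "a - p (x - x0) \<le> c" if "(x, a) \<in> G" for x a
    unfolding c_def using that zero
    by (intro cSup_upper bdd_aboveI[of _ "p x0"]) (auto dest: cross[OF _ zero])
  have upper: "c \<le> p (y + x0) - b" if "(y, b) \<in> G" for y b
    unfolding c_def using that zero by (intro cSup_least) (auto intro: cross)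
  have "a \<le> p x" if "(x, a) \<in> span (insert (x0, c) G)" for x a
  proof -
    from that G obtain t where t: "(x - t *\<^sub>R x0, a - t * c) \<in> G"
      by (auto simp: span_insert span_eq_iff[THEN iffD2])
    have scaled: "(s *\<^sub>R (x - t *\<^sub>R x0), s * (a - t * c)) \<in> G" for s
      using subspace_scale[OF G t, of s] by simp
    consider "t = 0" | "0 < t" | "t < 0" by linarith
    then show ?thesis
    proof cases
      case 1
      with t dom show ?thesis by simp
    next
      case 2
      have "c \<le> p (inverse t *\<^sub>R (x - t *\<^sub>R x0) + x0) - inverse t * (a - t * c)"
        by (rule upper[OF scaled])
      also have "inverse t *\<^sub>R (x - t *\<^sub>R x0) + x0 = inverse t *\<^sub>R x"
        using 2 by (simp add: scaleR_diff_right)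
      finally show ?thesis
        using 2 by (simp add: p_scale field_simps)
    next
      case 3
      have "inverse (- t) * (a - t * c) - p (inverse (- t) *\<^sub>R (x - t *\<^sub>R x0) - x0) \<le> c"
        by (rule lower[OF scaled])
      also have "inverse (- t) *\<^sub>R (x - t *\<^sub>R x0) - x0 = inverse (- t) *\<^sub>R x"
        using 3 by (simp add: scaleR_diff_right)
      finally have "inverse (- t) * (a - t * c) - inverse (- t) * p x \<le> c"
        using 3 by (subst (asm) p_scale) auto
      then show ?thesis
        using 3 by (simp add: field_simps)
    qed
  qed
  then show ?thesis by (rule that)
qed

text \<open>A graph that is maximal among the dominated ones is defined everywhere, since otherwise
  the one-step extension would enlarge it.\<close>
theorem hahn_banach_graph:
  fixes G :: "('a::real_vector \<times> real) set" and p :: "'a \<Rightarrow> real"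
  assumes p_add: "\<And>x y. p (x + y) \<le> p x + p y"
    and p_scale: "\<And>t x. 0 \<le> t \<Longrightarrow> p (t *\<^sub>R x) = t * p x"
    and G: "subspace G" and dom: "\<And>x a. (x, a) \<in> G \<Longrightarrow> a \<le> p x"
  obtains g where "linear g" "\<And>x a. (x, a) \<in> G \<Longrightarrow> g x = a" "\<And>x. g x \<le> p x"
proof -
  define \<A> where "\<A> = {H. subspace H \<and> G \<subseteq> H \<and> (\<forall>(x, a)\<in>H. a \<le> p x)}"
  have "\<exists>M\<in>\<A>. \<forall>H\<in>\<A>. M \<subseteq> H \<longrightarrow> H = M"
  proof (rule subset_Zorn_nonempty)
    show "\<A> \<noteq> {}"
      using G dom by (auto simp: \<A>_def)
    fix \<C> assume ne: "\<C> \<noteq> {}" and ch: "subset.chain \<A> \<C>"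
    have sub: "\<C> \<subseteq> \<A>" and total: "\<And>H K. H \<in> \<C> \<Longrightarrow> K \<in> \<C> \<Longrightarrow> H \<subseteq> K \<or> K \<subseteq> H"
      using ch by (auto simp: subset_chain_def)
    have subspaces: "\<And>H. H \<in> \<C> \<Longrightarrow> subspace H"
      using sub by (auto simp: \<A>_def)
    have "subspace (\<Union>\<C>)"
      unfolding subspace_def
    proof (intro conjI ballI allI)
      show "0 \<in> \<Union>\<C>"
        using ne subspaces subspace_0 by blast
      show "c *\<^sub>R x \<in> \<Union>\<C>" if "x \<in> \<Union>\<C>" for c x
        using that subspaces subspace_scale by blast
      fix x y assume "x \<in> \<Union>\<C>" "y \<in> \<Union>\<C>"
      then obtain H where "H \<in> \<C>" "x \<in> H" "y \<in> H"
        using total by blast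
      then show "x + y \<in> \<Union>\<C>"
        using subspaces subspace_add by blast
    qed
    then show "\<Union>\<C> \<in> \<A>"
      using ne sub by (auto simp: \<A>_def)
  qed
  then obtain M where "M \<in> \<A>" and max: "\<And>H. H \<in> \<A> \<Longrightarrow> M \<subseteq> H \<Longrightarrow> H = M"
    by blast
  then have M: "subspace M" "G \<subseteq> M" and domM: "\<And>x a. (x, a) \<in> M \<Longrightarrow> a \<le> p x"
    by (auto simp: \<A>_def)
  have total: "\<exists>a. (x, a) \<in> M" for x
  proof -
    obtain c where c: "\<And>y a. (y, a) \<in> span (insert (x, c) M) \<Longrightarrow> a \<le> p y"
      using dominated_graph_extend[OF p_add p_scale M(1) domM, of x] by metis
    have "insert (x, c) M \<subseteq> span (insert (x, c) M)"
      by (rule span_superset)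
    moreover from this have "span (insert (x, c) M) \<in> \<A>"
      using M(2) c by (auto simp: \<A>_def)
    ultimately show ?thesis
      using max by blast
  qed
  have p0: "p 0 = 0"
    using p_scale[of 0 0] by simp
  have single: "a = b" if "(x, a) \<in> M" "(x, b) \<in> M" for x a b
    using domM[of 0 "a - b"] domM[of 0 "b - a"] p0
      subspace_diff[OF M(1) that] subspace_diff[OF M(1) that(2,1)] by simp
  define g where "g x = (THE a. (x, a) \<in> M)" for x
  have g: "(x, g x) \<in> M" for x
    unfolding g_def using total single by (metis theI)
  have g_eq: "g x = a" if "(x, a) \<in> M" for x a
    using g single that by blast
  show ?thesis
  proof
    show "linear g"
    proof
      show "g (x + y) = g x + g y" for x y
        using subspace_add[OF M(1) g[of x] g[of y]] by (simp add: g_eq)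
      show "g (r *\<^sub>R x) = r *\<^sub>R g x" for r x
        using subspace_scale[OF M(1) g[of x], of r] by (simp add: g_eq)
    qed
    show "g x = a" if "(x, a) \<in> G" for x a
      using that M(2) g_eq by blast
    show "g x \<le> p x" for x
      using domM g by blast
  qed
qed

corollary hahn_banach_norm:
  fixes G :: "('a::real_normed_vector \<times> real) set"
  assumes G: "subspace G" and "0 \<le> C" and dom: "\<And>x a. (x, a) \<in> G \<Longrightarrow> a \<le> C * norm x"
  obtains \<phi> :: "'a \<Rightarrow>\<^sub>L real" where "\<And>x a. (x, a) \<in> G \<Longrightarrow> \<phi> x = a" "norm \<phi> \<le> C"
proof -
  obtain g where g: "linear g" "\<And>x a. (x, a) \<in> G \<Longrightarrow> g x = a" "\<And>x. g x \<le> C * norm x"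
  proof (rule hahn_banach_graph[of "\<lambda>x. C * norm x" G])
    show "C * norm (x + y) \<le> C * norm x + C * norm y" for x y :: 'a
      using \<open>0 \<le> C\<close> by (metis distrib_left mult_left_mono norm_triangle_ineq)
  qed (use G dom in auto)
  have bound: "norm (g x) \<le> C * norm x" for x
    using g(3)[of x] g(3)[of "- x"] linear_neg[OF g(1), of x] by auto
  then have bl: "bounded_linear g"
    using g(1) by (intro bounded_linear_intro[of _ C])
      (auto simp: linear_add linear_scale mult.commute)
  show ?thesis
  proof
    show "Blinfun g x = a" if "(x, a) \<in> G" for x a
      using g(2) that by (simp add: bounded_linear_Blinfun_apply[OF bl])
    show "norm (Blinfun g) \<le> C"
      using bound \<open>0 \<le> C\<close> by (intro norm_blinfun_bound) (auto simp: bounded_linear_Blinfun_apply[OF bl])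
  qed
qed

text \<open>The functional \<open>t *\<^sub>R x \<mapsto> t * norm x\<close> on the line through \<open>x\<close> is dominated by the norm.
  Giving it as a graph makes the case \<open>x = 0\<close> unexceptional.\<close>
corollary norming_functional:
  fixes x :: "'a::real_normed_vector"
  obtains \<phi> :: "'a \<Rightarrow>\<^sub>L real" where "norm \<phi> \<le> 1" "\<phi> x = norm x"
proof -
  have "\<exists>\<phi> :: 'a \<Rightarrow>\<^sub>L real. (\<forall>y a. (y, a) \<in> span {(x, norm x)} \<longrightarrow> blinfun_apply \<phi> y = a) \<and> norm \<phi> \<le> 1"
  proof (rule hahn_banach_norm[of "span {(x, norm x)}" 1])
    show "a \<le> 1 * norm y" if "(y, a) \<in> span {(x, norm x)}" for y a
      using that by (auto simp: span_singleton intro!: mult_right_mono)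
  qed auto
  moreover have "(x, norm x) \<in> span {(x, norm x)}"
    by (rule span_base) simp
  ultimately show ?thesis
    using that by blast
qed

lemma norm_le_by_functionals:
  fixes x :: "'a::real_normed_vector"
  assumes "\<And>\<phi> :: 'a \<Rightarrow>\<^sub>L real. norm \<phi> \<le> 1 \<Longrightarrow> blinfun_apply \<phi> x \<le> c"
  shows "norm x \<le> c"
  using norming_functional[of x] assms by metis

lemma eq_by_functionals:
  fixes x y :: "'a::real_normed_vector"
  assumes "\<And>\<phi> :: 'a \<Rightarrow>\<^sub>L real. blinfun_apply \<phi> x = blinfun_apply \<phi> y"
  shows "x = y"
  using norm_le_by_functionals[of "x - y" 0] assms by (simp add: blinfun.diff_right)

section \<open>Functionals on the dual that are evaluations\<close>

text \<open>By induction on the number of functionals. If some \<open>w\<close> in the common kernel of the old ones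
  has \<open>f j w \<noteq> 0\<close>, then subtracting the right multiple of \<open>f j\<close> from \<open>F\<close> makes it vanish at \<open>w\<close>,
  and hence on the whole common kernel of the old ones; otherwise \<open>f j\<close> may be ignored.\<close>
lemma functional_in_span_of_kernels:
  fixes F :: "'v::real_vector \<Rightarrow> real"
  assumes "finite I" "\<And>i. i \<in> I \<Longrightarrow> linear (f i)" "linear F"
    and "\<And>v. (\<And>i. i \<in> I \<Longrightarrow> f i v = 0) \<Longrightarrow> F v = 0"
  shows "\<exists>c. \<forall>v. F v = (\<Sum>i\<in>I. c i * f i v)"
  using assms
proof (induction I arbitrary: F rule: finite_induct)
  case empty
  then show ?case by simp
next
  case (insert j I)
  note lin = insert.prems(1)
  have ext: "\<exists>c. \<forall>v. F v = (\<Sum>i\<in>insert j I. c i * f i v)"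
    if "\<forall>v. F v - s * f j v = (\<Sum>i\<in>I. c i * f i v)" for s c
  proof (intro exI[of _ "c(j := s)"] allI)
    fix v
    have "(\<Sum>i\<in>I. (c(j := s)) i * f i v) = (\<Sum>i\<in>I. c i * f i v)"
      using insert.hyps by (intro sum.cong) auto
    then show "F v = (\<Sum>i\<in>insert j I. (c(j := s)) i * f i v)"
      using that[rule_format, of v] insert.hyps by simp
  qed
  show ?case
  proof (cases "\<exists>w. (\<forall>i\<in>I. f i w = 0) \<and> f j w \<noteq> 0")
    case True
    then obtain w where w: "\<And>i. i \<in> I \<Longrightarrow> f i w = 0" "f j w \<noteq> 0" by blast
    define s where "s = F w / f j w"
    have "\<exists>c. \<forall>v. F v - s * f j v = (\<Sum>i\<in>I. c i * f i v)"
    proof (rule insert.IH)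
      show "linear (\<lambda>v. F v - s * f j v)"
        using insert.prems(2) lin[of j]
        by (intro linearI) (auto simp: linear_add linear_scale algebra_simps)
      fix v assume v: "\<And>i. i \<in> I \<Longrightarrow> f i v = 0"
      let ?u = "v - (f j v / f j w) *\<^sub>R w"
      have "F ?u = 0"
      proof (rule insert.prems(3))
        show "f i ?u = 0" if "i \<in> insert j I" for i
          using that w v lin[OF that] by (auto simp: linear_diff linear_scale)
      qed
      then show "F v - s * f j v = 0"
        using insert.prems(2) by (simp add: linear_diff linear_scale s_def)
    qed (use lin in auto)
    then show ?thesis using ext by blast
  next
    case False
    have "\<exists>c. \<forall>v. F v = (\<Sum>i\<in>I. c i * f i v)"
      using False insert.prems by (intro insert.IH) auto
    then show ?thesis using ext[of 0] by auto
  qed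
qed

text \<open>A linear combination of evaluations at points of \<open>K\<close> is the evaluation at the linear
  combination of these points.\<close>
lemma evaluation_if_vanishes_on_annihilator:
  fixes F :: "('x::real_normed_vector \<Rightarrow>\<^sub>L real) \<Rightarrow> real"
  assumes "linear F" "finite K" "\<And>\<phi>. (\<And>k. k \<in> K \<Longrightarrow> blinfun_apply \<phi> k = 0) \<Longrightarrow> F \<phi> = 0"
  obtains z where "\<And>\<phi>. F \<phi> = blinfun_apply \<phi> z"
proof -
  have "\<exists>c. \<forall>\<phi>. F \<phi> = (\<Sum>k\<in>K. c k * blinfun_apply \<phi> k)"
    using assms by (intro functional_in_span_of_kernels)
      (auto intro!: linearI simp: blinfun.add_left blinfun.scaleR_left)
  then obtain c where "\<And>\<phi>. F \<phi> = (\<Sum>k\<in>K. c k * blinfun_apply \<phi> k)" by blast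
  then have "F \<phi> = blinfun_apply \<phi> (\<Sum>k\<in>K. c k *\<^sub>R k)" for \<phi>
    by (simp add: blinfun.sum_right blinfun.scaleR_right)
  then show ?thesis by (rule that)
qed

text \<open>A basic weak-star neighbourhood of \<open>0\<close> restricts only finitely many evaluations, so it
  contains the subspace annihilating finitely many points. A linear functional that is bounded on
  a subspace vanishes there.\<close>
lemma weak_star_continuous_functional:
  fixes F :: "('x::real_normed_vector \<Rightarrow>\<^sub>L real) \<Rightarrow> real"
  assumes lin: "linear F" and cont: "continuous_map weak_star_topology euclidean F"
  obtains z where "\<And>\<phi>. F \<phi> = blinfun_apply \<phi> z"
proof -
  have "openin weak_star_topology {\<phi> \<in> topspace weak_star_topology. F \<phi> \<in> {-1<..<1}}"
    by (intro openin_continuous_map_preimage[OF cont]) auto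
  then obtain U :: "('x \<Rightarrow> real) set" where "open U"
    and U: "{\<phi>. F \<phi> \<in> {-1<..<1}} = blinfun_apply -` U"
    by (auto simp: strong_operator_topology_topspace)
       (auto simp: strong_operator_topology_def openin_pullback_topology)
  have "blinfun_apply 0 \<in> U"
  proof -
    have "(0 :: 'x \<Rightarrow>\<^sub>L real) \<in> {\<phi>. F \<phi> \<in> {-1<..<1}}"
      using linear_0[OF lin] by simp
    then show ?thesis unfolding U by simp
  qed
  then obtain X where X: "blinfun_apply 0 \<in> PiE UNIV X" "finite {i. X i \<noteq> UNIV}" "PiE UNIV X \<subseteq> U"
    using product_topology_open_contains_basis[of "\<lambda>_. euclidean" UNIV U "blinfun_apply 0"] \<open>open U\<close>
    by (auto simp: open_fun_def)
  show ?thesis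
  proof (rule evaluation_if_vanishes_on_annihilator[OF lin X(2)])
    fix \<phi> :: "'x \<Rightarrow>\<^sub>L real"
    assume \<phi>: "\<And>k. k \<in> {i. X i \<noteq> UNIV} \<Longrightarrow> \<phi> k = 0"
    have small: "\<bar>F (t *\<^sub>R \<phi>)\<bar> < 1" for t
    proof -
      have "blinfun_apply (t *\<^sub>R \<phi>) k \<in> X k" for k
        using X(1) \<phi>[of k] by (cases "X k = UNIV") (auto simp: PiE_iff blinfun.scaleR_left)
      then have "t *\<^sub>R \<phi> \<in> blinfun_apply -` U"
        using X(3) by auto
      then show ?thesis unfolding U[symmetric] by auto
    qed
    show "F \<phi> = 0"
    proof (rule ccontr)
      assume "F \<phi> \<noteq> 0"
      then show False
        using small[of "inverse (F \<phi>)"] by (simp add: linear_scale[OF lin])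
    qed
  qed (rule that)
qed

text \<open>A special case of Grothendieck's completeness theorem, and the only place where the
  completeness of \<open>'x\<close> enters. On the annihilator \<open>N\<close> of a suitable finite set, \<open>F\<close> has
  norm at most \<open>e\<close>. Extend \<open>F\<close> from \<open>N\<close> to a functional \<open>\<Psi>\<close> of norm at most \<open>e\<close> on the
  whole dual; \<open>F - \<Psi>\<close> vanishes on \<open>N\<close> and is therefore an evaluation. So \<open>F\<close> is a norm limit of
  evaluations, and the points of evaluation form a Cauchy sequence because \<open>'x\<close> embeds
  isometrically into its bidual.\<close>
lemma approximable_functional_is_evaluation:
  fixes F :: "('x::banach \<Rightarrow>\<^sub>L real) \<Rightarrow> real"
  assumes lin: "linear F"
    and small: "\<And>e. 0 < e \<Longrightarrow> \<exists>K. finite K \<and>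
      (\<forall>\<phi>. (\<forall>k\<in>K. blinfun_apply \<phi> k = 0) \<longrightarrow> F \<phi> \<le> e * norm \<phi>)"
  obtains z where "\<And>\<phi>. F \<phi> = blinfun_apply \<phi> z"
proof -
  have approx: "\<exists>z. \<forall>\<phi>. \<bar>F \<phi> - blinfun_apply \<phi> z\<bar> \<le> e * norm \<phi>" if e: "0 < e" for e
  proof -
    obtain K where K: "finite K"
      and small_K: "\<And>\<phi>. \<forall>k\<in>K. blinfun_apply \<phi> k = 0 \<Longrightarrow> F \<phi> \<le> e * norm \<phi>"
      using small[OF e] by blast
    define N where "N = {\<phi> :: 'x \<Rightarrow>\<^sub>L real. \<forall>k\<in>K. blinfun_apply \<phi> k = 0}"
    have "subspace ((\<lambda>\<phi>. (\<phi>, F \<phi>)) ` N)"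
    proof (rule linear_subspace_image)
      show "linear (\<lambda>\<phi>. (\<phi>, F \<phi>))"
        using lin by (intro linearI) (auto simp: linear_add linear_scale)
      show "subspace N"
        by (auto simp: subspace_def N_def blinfun.add_left blinfun.scaleR_left)
    qed
    then obtain \<Psi> :: "('x \<Rightarrow>\<^sub>L real) \<Rightarrow>\<^sub>L real"
      where \<Psi>_graph: "\<And>\<phi> a. (\<phi>, a) \<in> (\<lambda>\<phi>. (\<phi>, F \<phi>)) ` N \<Longrightarrow> \<Psi> \<phi> = a" and "norm \<Psi> \<le> e"
      by (rule hahn_banach_norm[of _ e]) (use small_K e in \<open>auto simp: N_def\<close>)
    have \<Psi>: "\<Psi> \<phi> = F \<phi>" if "\<phi> \<in> N" for \<phi>
      using that by (intro \<Psi>_graph) blast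
    have "linear (\<lambda>\<phi>. F \<phi> - \<Psi> \<phi>)"
      using lin by (intro linearI)
        (auto simp: linear_add linear_scale blinfun.add_right blinfun.scaleR_right algebra_simps)
    then obtain z where z: "\<And>\<phi>. F \<phi> - \<Psi> \<phi> = blinfun_apply \<phi> z"
      by (rule evaluation_if_vanishes_on_annihilator[OF _ K]) (auto simp: \<Psi> N_def)
    have "\<bar>F \<phi> - blinfun_apply \<phi> z\<bar> \<le> e * norm \<phi>" for \<phi>
    proof -
      have "F \<phi> - blinfun_apply \<phi> z = \<Psi> \<phi>"
        using z[of \<phi>] by simp
      then show ?thesis
        using norm_blinfun[of \<Psi> \<phi>] \<open>norm \<Psi> \<le> e\<close>
        by (metis mult_right_mono norm_ge_zero order_trans real_norm_def)
    qed
    then show ?thesis by blast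
  qed
  then have "\<exists>z. \<forall>\<phi>. \<bar>F \<phi> - blinfun_apply \<phi> z\<bar> \<le> inverse (real (Suc n)) * norm \<phi>" for n
    by simp
  then obtain z where
    z: "\<And>n \<phi>. \<bar>F \<phi> - blinfun_apply \<phi> (z n)\<bar> \<le> inverse (real (Suc n)) * norm \<phi>"
    by metis
  have z_dist: "dist (z m) (z n) \<le> inverse (real (Suc m)) + inverse (real (Suc n))" for m n
    unfolding dist_norm
  proof (rule norm_le_by_functionals)
    fix \<phi> :: "'x \<Rightarrow>\<^sub>L real" assume "norm \<phi> \<le> 1"
    then have "inverse (real (Suc k)) * norm \<phi> \<le> inverse (real (Suc k))" for k
      by (simp add: mult_left_le)
    then show "\<phi> (z m - z n) \<le> inverse (real (Suc m)) + inverse (real (Suc n))"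
      using z[of \<phi> m] z[of \<phi> n] unfolding blinfun.diff_right
      by (smt (verit))
  qed
  have "Cauchy z"
  proof (rule metric_CauchyI)
    fix e :: real assume "0 < e"
    then obtain N where N: "inverse (real (Suc N)) < e / 2"
      using reals_Archimedean[of "e / 2"] by auto
    have "dist (z m) (z n) < e" if "N \<le> m" "N \<le> n" for m n
    proof -
      have "inverse (real (Suc k)) \<le> inverse (real (Suc N))" if "N \<le> k" for k
        using that by (simp add: le_imp_inverse_le)
      from this[OF that(1)] this[OF that(2)] show ?thesis
        using z_dist[of m n] N by linarith
    qed
    then show "\<exists>N. \<forall>m\<ge>N. \<forall>n\<ge>N. dist (z m) (z n) < e" by blast
  qed
  then obtain z' where z': "z \<longlonglongrightarrow> z'"
    using Cauchy_convergent convergent_def by blast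
  have "F \<phi> = blinfun_apply \<phi> z'" for \<phi>
  proof (rule LIMSEQ_unique)
    show "(\<lambda>n. blinfun_apply \<phi> (z n)) \<longlonglongrightarrow> blinfun_apply \<phi> z'"
      by (intro tendsto_intros z')
    have "(\<lambda>n. F \<phi> - blinfun_apply \<phi> (z n)) \<longlonglongrightarrow> 0"
    proof (rule Lim_null_comparison)
      show "(\<lambda>n. inverse (real (Suc n)) * norm \<phi>) \<longlonglongrightarrow> 0"
        using tendsto_mult_left_zero[OF LIMSEQ_inverse_real_of_nat] by simp
    qed (use z in auto)
    then show "(\<lambda>n. blinfun_apply \<phi> (z n)) \<longlonglongrightarrow> F \<phi>"
      by (rule LIM_zero_cancel[OF tendsto_minus_cancel, simplified])
  qed
  then show ?thesis by (rule that)
qed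

section \<open>Weak-star compactness of the dual ball\<close>

text \<open>Banach--Alaoglu: inside the space of all functions, the dual ball is the set of linear
  functions in a product of compact intervals, and linearity is a closed condition for pointwise
  convergence. The ball is taken as a set of functions because the weak-star topology is the one
  inherited from there.\<close>
lemma compact_dual_ball:
  "compact (blinfun_apply ` (cball 0 1 :: ('x::real_normed_vector \<Rightarrow>\<^sub>L real) set))"
proof -
  define P where "P = PiE UNIV (\<lambda>x::'x. {- norm x .. norm x})"
  have "compactin (product_topology (\<lambda>_::'x. euclideanreal) UNIV) P"
    unfolding P_def by (subst compactin_PiE) auto
  then have "compact P"
    by (simp add: euclidean_product_topology)
  moreover have "closed {u :: 'x \<Rightarrow> real. linear u}"
  proof -
    have eq: "{u :: 'x \<Rightarrow> real. linear u} =
        {u. (\<forall>x y. u (x + y) = u x + u y) \<and> (\<forall>c x. u (c *\<^sub>R x) = c * u x)}"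
      by (auto simp: linear_iff)
    show ?thesis
      unfolding eq
      by (intro closed_Collect_conj closed_Collect_all closed_Collect_eq
          continuous_intros continuous_on_product_coordinates)
  qed
  ultimately have "compact (P \<inter> {u. linear u})"
    by (rule compact_Int_closed)
  also have "P \<inter> {u. linear u} = blinfun_apply ` cball 0 1"
  proof (intro equalityI subsetI)
    fix u assume "u \<in> P \<inter> {u. linear u}"
    then have u: "linear u" "\<And>x. norm (u x) \<le> 1 * norm x"
      by (auto simp: P_def PiE_iff abs_le_iff minus_le_iff)
    then have bl: "bounded_linear u"
      by (intro bounded_linear_intro[of _ 1]) (auto simp: linear_add linear_scale)
    have "norm (Blinfun u) \<le> 1"
      using u(2) by (intro norm_blinfun_bound) (auto simp: bounded_linear_Blinfun_apply[OF bl])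
    then show "u \<in> blinfun_apply ` cball 0 1"
      by (intro image_eqI[of _ _ "Blinfun u"]) (auto simp: bounded_linear_Blinfun_apply[OF bl])
  next
    fix u :: "'x \<Rightarrow> real" assume "u \<in> blinfun_apply ` cball 0 1"
    then obtain \<phi> where \<phi>: "u = blinfun_apply \<phi>" "norm \<phi> \<le> 1" by auto
    have "\<bar>\<phi> x\<bar> \<le> norm x" for x
      using norm_blinfun[of \<phi> x] mult_right_mono[OF \<phi>(2), of "norm x"] by simp
    then show "u \<in> P \<inter> {u. linear u}"
      by (auto simp: P_def \<phi>(1) PiE_iff abs_le_iff minus_le_iff
          blinfun.bounded_linear_right bounded_linear.linear)
  qed
  finally show ?thesis .
qed

section \<open>Uniform decay of difference quotients\<close>

text \<open>The two limits that define \<open>S(M,X)\<close> amount to a single condition without suprema: up to any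
  \<open>e > 0\<close>, all difference quotients are negligible except those of pairs in some ball whose points
  are some \<open>\<delta>\<close> apart.\<close>
lemma S_set_iff:
  fixes f :: "'m::pointed_metric_space \<Rightarrow> 'x::real_normed_vector"
  shows "f \<in> S_set \<longleftrightarrow> f \<in> Lip \<and> (\<forall>e>0. \<exists>\<delta>>0. \<exists>r. \<forall>x y.
    dist x y < \<delta> \<or> x \<notin> ball origin r \<or> y \<notin> ball origin r \<longrightarrow>
    norm (f x - f y) \<le> e * dist x y)" (is "_ \<longleftrightarrow> _ \<and> ?decay")
proof (intro iffI conjI)
  assume f: "f \<in> S_set"
  then show Lip: "f \<in> Lip" by (rule S_set_Lip)
  have bound: "norm (f x - f y) \<le> e * dist x y" if "slope_sup f P < e" "P x y" for P x y e
  proof (cases "x = y")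
    case False
    then have "norm (f x - f y) / dist x y < e"
      using slope_sup_upper[OF Lip False, of P] that by fastforce
    with False show ?thesis
      by (simp add: pos_divide_less_eq)
  qed simp
  show ?decay
  proof (intro allI impI)
    fix e :: real assume "0 < e"
    have local: "((\<lambda>\<epsilon>. slope_sup f (\<lambda>x y. dist x y < \<epsilon>)) \<longlongrightarrow> 0) (at_right 0)"
      and far: "((\<lambda>r. slope_sup f (\<lambda>x y. x \<notin> ball origin r \<or> y \<notin> ball origin r)) \<longlongrightarrow> 0) at_top"
      using f by (simp_all add: S_set_def little_lip_def)
    obtain b where "0 < b"
      and b: "\<And>\<epsilon>. 0 < \<epsilon> \<Longrightarrow> \<epsilon> < b \<Longrightarrow> slope_sup f (\<lambda>x y. dist x y < \<epsilon>) < e"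
      using order_tendstoD(2)[OF local \<open>0 < e\<close>] unfolding eventually_at_right_field by blast
    then obtain \<delta> where "0 < \<delta>" and \<delta>: "slope_sup f (\<lambda>x y. dist x y < \<delta>) < e"
      by (metis dense)
    obtain r where r: "slope_sup f (\<lambda>x y. x \<notin> ball origin r \<or> y \<notin> ball origin r) < e"
      using order_tendstoD(2)[OF far \<open>0 < e\<close>] unfolding eventually_at_top_linorder by blast
    show "\<exists>\<delta>>0. \<exists>r. \<forall>x y. dist x y < \<delta> \<or> x \<notin> ball origin r \<or> y \<notin> ball origin r \<longrightarrow>
        norm (f x - f y) \<le> e * dist x y"
      using \<open>0 < \<delta>\<close> bound[OF \<delta>] bound[OF r] by blast
  qed
next
  assume f: "f \<in> Lip \<and> ?decay"
  have small: "\<bar>slope_sup f P\<bar> < e"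
    if "0 < e" "\<And>x y. P x y \<Longrightarrow> norm (f x - f y) \<le> e / 2 * dist x y" for P e
  proof -
    have "slope_sup f P \<le> e / 2"
      using that by (intro slope_sup_least) (auto simp: divide_le_eq)
    with slope_sup_nonneg[of f P] f \<open>0 < e\<close> show ?thesis by auto
  qed
  have "((\<lambda>\<epsilon>. slope_sup f (\<lambda>x y. dist x y < \<epsilon>)) \<longlongrightarrow> 0) (at_right 0)"
  proof (rule tendstoI)
    fix e :: real assume "0 < e"
    then obtain \<delta> where "0 < \<delta>"
      and \<delta>: "\<And>x y. dist x y < \<delta> \<Longrightarrow> norm (f x - f y) \<le> e / 2 * dist x y"
      using f[THEN conjunct2, rule_format, of "e / 2"] by auto
    have "\<bar>slope_sup f (\<lambda>x y. dist x y < \<epsilon>)\<bar> < e" if "\<epsilon> < \<delta>" for \<epsilon>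
      using \<delta> that by (intro small[OF \<open>0 < e\<close>]) (meson less_trans)
    then show "\<forall>\<^sub>F \<epsilon> in at_right 0. dist (slope_sup f (\<lambda>x y. dist x y < \<epsilon>)) 0 < e"
      using \<open>0 < \<delta>\<close> unfolding eventually_at_right_field dist_real_def by auto
  qed
  moreover have "((\<lambda>r. slope_sup f (\<lambda>x y. x \<notin> ball origin r \<or> y \<notin> ball origin r)) \<longlongrightarrow> 0) at_top"
  proof (rule tendstoI)
    fix e :: real assume "0 < e"
    then obtain r where r: "\<And>x y. x \<notin> ball origin r \<or> y \<notin> ball origin r \<Longrightarrow>
        norm (f x - f y) \<le> e / 2 * dist x y"
      using f[THEN conjunct2, rule_format, of "e / 2"] by fastforce
    have "\<bar>slope_sup f (\<lambda>x y. x \<notin> ball origin s \<or> y \<notin> ball origin s)\<bar> < e" if "r \<le> s" for s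
    proof (rule small[OF \<open>0 < e\<close>])
      show "norm (f x - f y) \<le> e / 2 * dist x y"
        if "x \<notin> ball origin s \<or> y \<notin> ball origin s" for x y
        using that subset_ball[OF \<open>r \<le> s\<close>, of origin] by (intro r) blast
    qed
    then show "\<forall>\<^sub>F r in at_top.
        dist (slope_sup f (\<lambda>x y. x \<notin> ball origin r \<or> y \<notin> ball origin r)) 0 < e"
      unfolding eventually_at_top_linorder dist_real_def by auto
  qed
  ultimately show "f \<in> S_set"
    using f by (simp add: S_set_def little_lip_def)
qed

lemma S_eqI: "(\<And>x. S_apply f x = S_apply g x) \<Longrightarrow> f = g"
  by (metis S_apply_inject ext)

lemma S_apply_origin: "S_apply f origin = 0"
  using S_set_Lip[OF S_apply[of f]] by (simp add: Lip_def)

lemma S_lipschitz: "norm (S_apply f x - S_apply f y) \<le> norm f * dist x y"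
proof (cases "x = y")
  case False
  with slope_sup_upper[OF S_set_Lip[OF S_apply[of f]] this, of "\<lambda>_ _. True"] show ?thesis
    by (simp add: norm_S.rep_eq Lip_norm_def pos_divide_le_eq)
qed simp

lemma S_norm_le:
  assumes "0 \<le> c" "\<And>x y. norm (S_apply f x - S_apply f y) \<le> c * dist x y"
  shows "norm f \<le> c"
  unfolding norm_S.rep_eq Lip_norm_def
  using assms by (intro slope_sup_least) (auto simp: divide_le_eq)

lemma S_decay:
  assumes "0 < e"
  obtains \<delta> r where "0 < \<delta>" "\<And>x y. dist x y < \<delta> \<or> x \<notin> ball origin r \<or> y \<notin> ball origin r \<Longrightarrow>
    norm (S_apply f x - S_apply f y) \<le> e * dist x y"
  using S_apply[of f] assms unfolding S_set_iff by metis

lemma S_decay_finite: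
  fixes \<G> :: "('m::pointed_metric_space, 'x::real_normed_vector) S set"
  assumes "finite \<G>" "0 < e"
  shows "\<exists>\<delta>>0. \<exists>r. \<forall>g\<in>\<G>. \<forall>x y. dist x y < \<delta> \<or> x \<notin> ball origin r \<or> y \<notin> ball origin r \<longrightarrow>
    norm (S_apply g x - S_apply g y) \<le> e * dist x y"
  using assms(1)
proof (induction rule: finite_induct)
  case (insert g \<G>)
  obtain \<delta> r where 1: "0 < \<delta>" "\<And>h x y. h \<in> \<G> \<Longrightarrow>
      dist x y < \<delta> \<or> x \<notin> ball origin r \<or> y \<notin> ball origin r \<Longrightarrow>
      norm (S_apply h x - S_apply h y) \<le> e * dist x y"
    using insert.IH by blast
  obtain \<delta>' r' where 2: "0 < \<delta>'" "\<And>x y.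
      dist x y < \<delta>' \<or> x \<notin> ball origin r' \<or> y \<notin> ball origin r' \<Longrightarrow>
      norm (S_apply g x - S_apply g y) \<le> e * dist x y"
    using S_decay[OF \<open>0 < e\<close>, of g] by metis
  have "norm (S_apply h x - S_apply h y) \<le> e * dist x y"
    if "h \<in> insert g \<G>"
      and "dist x y < min \<delta> \<delta>' \<or> x \<notin> ball origin (max r r') \<or> y \<notin> ball origin (max r r')"
    for h x y
    using that 1(2)[of h x y] 2(2)[of x y]
      subset_ball[of r "max r r'" origin] subset_ball[of r' "max r r'" origin]
    by (metis insertE max.cobounded1 max.cobounded2 min_less_iff_conj subsetD)
  moreover have "0 < min \<delta> \<delta>'"
    using 1(1) 2(1) by simp
  ultimately show ?case by blast
qed (auto intro: exI[of _ 1])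

lemma ex_small_factor:
  fixes c e :: real
  assumes "0 \<le> c" "0 < e"
  obtains d where "0 < d" "c * d \<le> e"
  using assms by (intro that[of "e / (c + 1)"]) (auto simp: field_simps)

lemma S_set_compose:
  assumes f: "f \<in> S_set"
  shows "(\<lambda>x. blinfun_apply \<phi> (f x)) \<in> S_set"
  unfolding S_set_iff
proof (intro conjI allI impI)
  have diff: "norm (\<phi> (f x) - \<phi> (f y)) \<le> norm \<phi> * norm (f x - f y)" for x y
    using norm_blinfun[of \<phi> "f x - f y"] by (simp add: blinfun.diff_right)
  obtain C where "C-lipschitz_on UNIV f" "f origin = 0"
    using S_set_Lip[OF f] by (auto simp: Lip_def)
  have "(norm \<phi> * C)-lipschitz_on UNIV (\<lambda>x. \<phi> (f x))"
  proof (rule lipschitz_onI)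
    show "0 \<le> norm \<phi> * C"
      using lipschitz_on_nonneg[OF \<open>C-lipschitz_on UNIV f\<close>] by simp
    fix x y
    have "norm (f x - f y) \<le> C * dist x y"
      using lipschitz_onD[OF \<open>C-lipschitz_on UNIV f\<close>, of x y] by (simp add: dist_norm)
    then have "norm \<phi> * norm (f x - f y) \<le> norm \<phi> * (C * dist x y)"
      by (rule mult_left_mono) simp
    then show "dist (\<phi> (f x)) (\<phi> (f y)) \<le> norm \<phi> * C * dist x y"
      using diff[of x y] by (simp add: dist_norm)
  qed
  then show "(\<lambda>x. \<phi> (f x)) \<in> Lip"
    using \<open>f origin = 0\<close> by (auto simp: Lip_def)
  fix e :: real assume "0 < e"
  obtain e' where "0 < e'" and e': "norm \<phi> * e' \<le> e"
    using ex_small_factor[OF norm_ge_zero \<open>0 < e\<close>] by metis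
  obtain \<delta> r where "0 < \<delta>" and decay: "\<And>x y.
      dist x y < \<delta> \<or> x \<notin> ball origin r \<or> y \<notin> ball origin r \<Longrightarrow> norm (f x - f y) \<le> e' * dist x y"
    using f \<open>0 < e'\<close> unfolding S_set_iff by metis
  have "norm (\<phi> (f x) - \<phi> (f y)) \<le> e * dist x y"
    if "dist x y < \<delta> \<or> x \<notin> ball origin r \<or> y \<notin> ball origin r" for x y
  proof -
    have "norm (\<phi> (f x) - \<phi> (f y)) \<le> norm \<phi> * (e' * dist x y)"
      using diff[of x y] mult_left_mono[OF decay[OF that], of "norm \<phi>"] by simp
    also have "\<dots> \<le> e * dist x y"
      using mult_right_mono[OF e', of "dist x y"] by (simp add: mult.assoc)
    finally show ?thesis .
  qed
  then show "\<exists>\<delta>>0. \<exists>r. \<forall>x y. dist x y < \<delta> \<or> x \<notin> ball origin r \<or> y \<notin> ball origin r \<longrightarrow>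
      norm (\<phi> (f x) - \<phi> (f y)) \<le> e * dist x y"
    using \<open>0 < \<delta>\<close> by blast
qed

section \<open>The operator defined by a vector-valued function\<close>
definition S_compose ::
    "('x::real_normed_vector \<Rightarrow>\<^sub>L 'y::real_normed_vector) \<Rightarrow> ('m::pointed_metric_space, 'x) S \<Rightarrow> ('m, 'y) S"
  where "S_compose \<phi> f = Abs_S (\<lambda>x. blinfun_apply \<phi> (S_apply f x))"

lemma S_apply_compose [simp]: "S_apply (S_compose \<phi> f) x = \<phi> (S_apply f x)"
  by (simp add: S_compose_def Abs_S_inverse S_set_compose S_apply)

lemma norm_S_compose: "norm (S_compose \<phi> f) \<le> norm \<phi> * norm f"
proof (rule S_norm_le)
  fix x y
  have "norm (\<phi> (S_apply f x - S_apply f y)) \<le> norm \<phi> * (norm f * dist x y)"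
    using norm_blinfun[of \<phi>] mult_left_mono[OF S_lipschitz[of f x y], of "norm \<phi>"]
    by (meson norm_ge_zero order_trans)
  then show "norm (S_apply (S_compose \<phi> f) x - S_apply (S_compose \<phi> f) y)
      \<le> norm \<phi> * norm f * dist x y"
    by (simp add: blinfun.diff_right mult.assoc)
qed simp

text \<open>If \<open>f\<close> is regarded as an \<open>X\<close>-valued linear map, sending the point mass at \<open>x\<close> to \<open>f x\<close>,
  then this is its adjoint.\<close>
definition dual_operator ::
    "('m::pointed_metric_space, 'x::real_normed_vector) S \<Rightarrow> ('x \<Rightarrow>\<^sub>L real) \<Rightarrow>\<^sub>L ('m, real) S"
  where "dual_operator f = Blinfun (\<lambda>\<phi>. S_compose \<phi> f)"

lemma S_apply_dual_operator [simp]: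
  fixes f :: "('m::pointed_metric_space, 'x::real_normed_vector) S"
  shows "S_apply (blinfun_apply (dual_operator f) \<phi>) x = blinfun_apply \<phi> (S_apply f x)"
proof -
  have "bounded_linear (\<lambda>\<phi> :: 'x \<Rightarrow>\<^sub>L real. S_compose \<phi> f)"
  proof (rule bounded_linear_intro)
    show "norm (S_compose \<phi> f) \<le> norm \<phi> * norm f" for \<phi> :: "'x \<Rightarrow>\<^sub>L real"
      by (rule norm_S_compose)
  qed (auto intro!: S_eqI simp: plus_S.rep_eq scaleR_S.rep_eq blinfun.add_left blinfun.scaleR_left)
  then show ?thesis
    by (simp add: dual_operator_def bounded_linear_Blinfun_apply)
qed

lemma linear_dual_operator: "linear dual_operator"
  by (intro linearI blinfun_eqI S_eqI)
    (simp_all add: blinfun.add_left blinfun.add_right blinfun.scaleR_left blinfun.scaleR_right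
      plus_S.rep_eq scaleR_S.rep_eq)

text \<open>For the lower bound, a norming functional of \<open>f x - f y\<close> turns a difference quotient of \<open>f\<close>
  into one of the scalar function \<open>\<phi> \<circ> f\<close>.\<close>
lemma norm_dual_operator:
  fixes f :: "('m::pointed_metric_space, 'x::real_normed_vector) S"
  shows "norm (dual_operator f) = norm f"
proof (rule antisym)
  show "norm (dual_operator f) \<le> norm f"
  proof (rule norm_blinfun_bound)
    fix \<phi>
    have "dual_operator f \<phi> = S_compose \<phi> f"
      by (rule S_eqI) simp
    then show "norm (dual_operator f \<phi>) \<le> norm f * norm \<phi>"
      using norm_S_compose[of \<phi> f] by (simp add: mult.commute)
  qed simp
  show "norm f \<le> norm (dual_operator f)"
  proof (rule S_norm_le, simp, rule norm_le_by_functionals)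
    fix x y and \<phi> :: "'x \<Rightarrow>\<^sub>L real" assume "norm \<phi> \<le> 1"
    have "\<phi> (S_apply f x - S_apply f y) \<le> norm (dual_operator f \<phi>) * dist x y"
      using S_lipschitz[of "dual_operator f \<phi>" x y] by (simp add: blinfun.diff_right)
    also have "\<dots> \<le> norm (dual_operator f) * dist x y"
    proof (rule mult_right_mono)
      show "norm (dual_operator f \<phi>) \<le> norm (dual_operator f)"
        using norm_blinfun[of "dual_operator f" \<phi>]
          mult_left_mono[OF \<open>norm \<phi> \<le> 1\<close>, of "norm (dual_operator f)"] by simp
    qed simp
    finally show "\<phi> (S_apply f x - S_apply f y) \<le> norm (dual_operator f) * dist x y" .
  qed
qed

section \<open>Compactness and weak-star to weak continuity\<close>

text \<open>Properness enters here: the pairs with a non-negligible difference quotient lie in a compact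
  set on which the quotient is continuous, so finitely many vectors approximate all of them. The
  vector \<open>0\<close> accounts for the negligible quotients. Multiplying by the distance covers \<open>x = y\<close>.\<close>
lemma slopes_totally_bounded:
  fixes f :: "('m::pointed_metric_space, 'x::real_normed_vector) S"
  assumes "proper_metric TYPE('m)" and "0 < e"
  obtains K where "finite K"
    "\<And>x y. \<exists>k\<in>K. norm (S_apply f x - S_apply f y - dist x y *\<^sub>R k) \<le> e * dist x y"
proof -
  obtain \<delta> r where "0 < \<delta>" and decay: "\<And>x y.
      dist x y < \<delta> \<or> x \<notin> ball origin r \<or> y \<notin> ball origin r \<Longrightarrow>
      norm (S_apply f x - S_apply f y) \<le> e * dist x y"
    using S_decay[OF \<open>0 < e\<close>] by metis
  define P where "P = (cball origin r \<times> cball origin r) \<inter> {p :: 'm \<times> 'm. \<delta> \<le> dist (fst p) (snd p)}"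
  define slope where "slope p = (S_apply f (fst p) - S_apply f (snd p)) /\<^sub>R dist (fst p) (snd p)" for p
  have "compact (cball (origin :: 'm) r)"
    using assms(1) by (simp add: proper_metric_def)
  then have "compact P"
    unfolding P_def by (intro compact_Int_closed compact_Times closed_Collect_le continuous_intros)
  moreover have "continuous_on P slope"
  proof -
    have "(norm f)-lipschitz_on UNIV (S_apply f)"
      by (rule lipschitz_onI) (simp_all add: S_lipschitz dist_norm)
    then have "continuous_on UNIV (S_apply f)"
      by (rule lipschitz_on_continuous_on)
    then have cont: "continuous_on P (\<lambda>p. S_apply f (g p))" if "continuous_on P g" for g :: "'m \<times> 'm \<Rightarrow> 'm"
      by (rule continuous_on_compose2[OF _ that]) simp
    show ?thesis
      unfolding slope_def using \<open>0 < \<delta>\<close>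
      by (intro continuous_intros cont) (auto simp: P_def)
  qed
  ultimately have "compact (slope ` P)"
    by (rule compact_continuous_image[rotated])
  then obtain K where K: "finite K" "slope ` P \<subseteq> (\<Union>k\<in>K. ball k e)"
    using compact_imp_seq_compact[THEN seq_compact_imp_totally_bounded] \<open>0 < e\<close> by metis
  show ?thesis
  proof
    show "finite (insert 0 K)"
      using K(1) by simp
    fix x y
    show "\<exists>k\<in>insert 0 K. norm (S_apply f x - S_apply f y - dist x y *\<^sub>R k) \<le> e * dist x y"
    proof (cases "(x, y) \<in> P")
      case True
      then have "0 < dist x y"
        using \<open>0 < \<delta>\<close> by (auto simp: P_def)
      obtain k where "k \<in> K" "norm (slope (x, y) - k) < e"
        using K(2) True by (force simp: dist_norm norm_minus_commute)
      moreover have "S_apply f x - S_apply f y - dist x y *\<^sub>R k = dist x y *\<^sub>R (slope (x, y) - k)"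
        using \<open>0 < dist x y\<close> by (simp add: slope_def scaleR_diff_right)
      ultimately show ?thesis
        using mult_left_mono[of "norm (slope (x, y) - k)" e "dist x y"]
        by (intro bexI[of _ k]) (auto simp: mult.commute)
    next
      case False
      then show ?thesis
        using decay[of x y] by (intro bexI[of _ 0]) (auto simp: P_def)
    qed
  qed
qed

text \<open>Each difference quotient of \<open>\<phi> \<circ> f\<close> is the value of \<open>\<phi>\<close> at a
  difference quotient of \<open>f\<close>, hence within \<open>e * norm \<phi>\<close> of a value of \<open>\<phi>\<close> on the finite net \<open>K\<close>.
  The estimate makes the operator weak-star to norm continuous on bounded sets (use it for differences) and
  small on the annihilator of \<open>K\<close> (take \<open>c = 0\<close>).\<close>
lemma dual_operator_finitely_controlled:
  fixes f :: "('m::pointed_metric_space, 'x::real_normed_vector) S"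
  assumes "proper_metric TYPE('m)" and "0 < e"
  obtains K where "finite K"
    "\<And>\<phi> c. 0 \<le> c \<Longrightarrow> (\<And>k. k \<in> K \<Longrightarrow> \<bar>blinfun_apply \<phi> k\<bar> \<le> c) \<Longrightarrow> norm (dual_operator f \<phi>) \<le> c + e * norm \<phi>"
proof -
  obtain K where K: "finite K"
    and near: "\<And>x y. \<exists>k\<in>K. norm (S_apply f x - S_apply f y - dist x y *\<^sub>R k) \<le> e * dist x y"
    using slopes_totally_bounded[OF assms] by metis
  show ?thesis
  proof
    fix \<phi> :: "'x \<Rightarrow>\<^sub>L real" and c :: real
    assume "0 \<le> c" and c: "\<And>k. k \<in> K \<Longrightarrow> \<bar>\<phi> k\<bar> \<le> c"
    show "norm (dual_operator f \<phi>) \<le> c + e * norm \<phi>"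
    proof (rule S_norm_le)
      show "0 \<le> c + e * norm \<phi>"
        using \<open>0 \<le> c\<close> \<open>0 < e\<close> by simp
      fix x y
      obtain k where "k \<in> K"
        and k: "norm (S_apply f x - S_apply f y - dist x y *\<^sub>R k) \<le> e * dist x y"
        using near by blast
      have "\<bar>\<phi> (S_apply f x - S_apply f y - dist x y *\<^sub>R k)\<bar> \<le> norm \<phi> * (e * dist x y)"
        using norm_blinfun[of \<phi>] mult_left_mono[OF k, of "norm \<phi>"]
        by (metis norm_ge_zero order_trans real_norm_def)
      moreover have "\<bar>dist x y * \<phi> k\<bar> \<le> dist x y * c"
        using c[OF \<open>k \<in> K\<close>] by (simp add: abs_mult mult_left_mono)
      ultimately show "norm (S_apply (dual_operator f \<phi>) x - S_apply (dual_operator f \<phi>) y)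
          \<le> (c + e * norm \<phi>) * dist x y"
        by (simp add: blinfun.diff_right blinfun.scaleR_right) (simp add: algebra_simps)
    qed
  qed (rule K)
qed

text \<open>The image of the dual ball is a continuous image of a weak-star compact set, so it
  is compact and in particular closed.\<close>
lemma compact_dual_operator:
  fixes f :: "('m::pointed_metric_space, 'x::real_normed_vector) S"
  assumes "proper_metric TYPE('m)"
  shows "compact_operator (dual_operator f)"
proof -
  let ?B = "blinfun_apply ` (cball 0 1 :: ('x \<Rightarrow>\<^sub>L real) set)"
  let ?T = "\<lambda>u. dual_operator f (Blinfun u)"
  have "continuous_on ?B ?T"
    unfolding continuous_on_def
  proof (intro ballI tendstoI)
    fix u :: "'x \<Rightarrow> real" and e :: real
    assume "u \<in> ?B" "0 < e"
    then obtain \<phi> where \<phi>: "u = blinfun_apply \<phi>" "norm \<phi> \<le> 1" by auto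
    obtain K where K: "finite K" and control: "\<And>\<psi> c. 0 \<le> c \<Longrightarrow>
        (\<And>k. k \<in> K \<Longrightarrow> \<bar>blinfun_apply \<psi> k\<bar> \<le> c) \<Longrightarrow> norm (dual_operator f \<psi>) \<le> c + e / 4 * norm \<psi>"
      using dual_operator_finitely_controlled[OF assms, of "e / 4" f] \<open>0 < e\<close> by auto
    \<comment> \<open>Two elements of the ball are at most \<open>2\<close> apart, so the estimate with \<open>e / 4\<close> yields
      \<open>e / 4 + e / 4 * 2\<close>, which is less than \<open>e\<close>.\<close>
    have "\<forall>\<^sub>F v in at u within ?B. \<forall>k\<in>K. dist (v k) (u k) < e / 4"
    proof (rule eventually_ball_finite[OF K], intro ballI tendstoD)
      show "((\<lambda>v. v k) \<longlongrightarrow> u k) (at u within ?B)" for k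
        using continuous_on_product_coordinates[of k]
        by (metis UNIV_I continuous_on_def tendsto_within_subset subset_UNIV)
    qed (use \<open>0 < e\<close> in simp)
    moreover have "\<forall>\<^sub>F v in at u within ?B. v \<in> ?B"
      by (simp add: eventually_at_filter)
    ultimately show "\<forall>\<^sub>F v in at u within ?B. dist (?T v) (?T u) < e"
    proof eventually_elim
      case (elim v)
      then obtain \<psi> where \<psi>: "v = blinfun_apply \<psi>" "norm \<psi> \<le> 1" by auto
      have "norm (dual_operator f (\<psi> - \<phi>)) \<le> e / 4 + e / 4 * norm (\<psi> - \<phi>)"
        using elim(1) \<open>0 < e\<close> by (intro control)
          (auto simp: \<phi>(1) \<psi>(1) dist_real_def blinfun.diff_left intro: less_imp_le)
      moreover have "norm (\<psi> - \<phi>) \<le> 2"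
        using norm_triangle_ineq4[of \<psi> \<phi>] \<phi>(2) \<psi>(2) by simp
      then have "e / 4 * norm (\<psi> - \<phi>) \<le> e / 4 * 2"
        using \<open>0 < e\<close> by (intro mult_left_mono) auto
      ultimately have "norm (dual_operator f (\<psi> - \<phi>)) < e"
        using \<open>0 < e\<close> by linarith
      then show ?case
        by (simp add: \<phi>(1) \<psi>(1) blinfun_apply_inverse dist_norm blinfun.diff_right)
    qed
  qed
  then have "compact (?T ` ?B)"
    by (rule compact_continuous_image[OF _ compact_dual_ball])
  also have "?T ` ?B = dual_operator f ` cball 0 1"
    by (simp add: image_image blinfun_apply_inverse)
  finally show ?thesis
    by (simp add: compact_operator_def closure_closed compact_imp_closed)
qed

lemma continuous_map_weak_topology_iff:
  "continuous_map X weak_topology g \<longleftrightarrow>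
    (\<forall>\<psi> :: 'y::real_normed_vector \<Rightarrow>\<^sub>L real. continuous_map X euclidean (\<lambda>a. blinfun_apply \<psi> (g a)))"
proof (intro iffI conjI allI)
  fix \<psi> :: "'y \<Rightarrow>\<^sub>L real"
  assume g: "continuous_map X weak_topology g"
  have "continuous_map weak_topology euclidean ((\<lambda>u. u \<psi>) \<circ> (\<lambda>y (\<psi> :: 'y \<Rightarrow>\<^sub>L real). blinfun_apply \<psi> y))"
    unfolding weak_topology_def
    by (rule continuous_map_pullback) (simp add: continuous_on_product_coordinates)
  from continuous_map_compose[OF g this]
  show "continuous_map X euclidean (\<lambda>a. blinfun_apply \<psi> (g a))"
    by (simp add: o_def)
next
  assume "\<forall>\<psi> :: 'y \<Rightarrow>\<^sub>L real. continuous_map X euclidean (\<lambda>a. blinfun_apply \<psi> (g a))"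
  then have "continuous_map X (product_topology (\<lambda>_. euclideanreal) UNIV) (\<lambda>a (\<psi> :: 'y \<Rightarrow>\<^sub>L real). blinfun_apply \<psi> (g a))"
    by (simp add: continuous_map_componentwise_UNIV)
  then show "continuous_map X weak_topology g"
    unfolding weak_topology_def
    by (intro continuous_map_pullback') (simp_all add: o_def euclidean_product_topology)
qed

text \<open>Weak-star continuity on bounded sets has to be upgraded to the whole dual. For \<open>\<psi>\<close> in the dual
  of \<open>S(M)\<close> the functional \<open>\<phi> \<mapsto> \<psi> (dual_operator f \<phi>)\<close> is small on annihilators of finite sets,
  so it is an evaluation by completeness of \<open>'x\<close>, and evaluations are weak-star continuous.\<close>
lemma dual_operator_weak_star_weak_continuous:
  fixes f :: "('m::pointed_metric_space, 'x::banach) S"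
  assumes "proper_metric TYPE('m)"
  shows "continuous_map weak_star_topology weak_topology (blinfun_apply (dual_operator f))"
  unfolding continuous_map_weak_topology_iff
proof (intro conjI allI)
  fix \<psi> :: "('m, real) S \<Rightarrow>\<^sub>L real"
  obtain z where z: "\<And>\<phi>. \<psi> (dual_operator f \<phi>) = blinfun_apply \<phi> z"
  proof (rule approximable_functional_is_evaluation)
    show "linear (\<lambda>\<phi>. \<psi> (dual_operator f \<phi>))"
      by (intro linearI) (simp_all add: blinfun.add_right blinfun.scaleR_right)
    fix e :: real assume "0 < e"
    obtain e' where "0 < e'" and e': "norm \<psi> * e' \<le> e"
      using ex_small_factor[OF norm_ge_zero \<open>0 < e\<close>] by metis
    obtain K where K: "finite K" and control: "\<And>\<phi> c. 0 \<le> c \<Longrightarrow>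
        (\<And>k. k \<in> K \<Longrightarrow> \<bar>blinfun_apply \<phi> k\<bar> \<le> c) \<Longrightarrow> norm (dual_operator f \<phi>) \<le> c + e' * norm \<phi>"
      using dual_operator_finitely_controlled[OF assms \<open>0 < e'\<close>, of f] by auto
    have "\<psi> (dual_operator f \<phi>) \<le> e * norm \<phi>" if "\<forall>k\<in>K. blinfun_apply \<phi> k = 0" for \<phi>
    proof -
      have "norm (dual_operator f \<phi>) \<le> e' * norm \<phi>"
        using control[of 0 \<phi>] that by simp
      then have "norm \<psi> * norm (dual_operator f \<phi>) \<le> norm \<psi> * (e' * norm \<phi>)"
        by (rule mult_left_mono) simp
      also have "\<dots> \<le> e * norm \<phi>"
        using mult_right_mono[OF e', of "norm \<phi>"] by (simp add: mult.assoc)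
      finally show ?thesis
        using norm_blinfun[of \<psi> "dual_operator f \<phi>"] by simp
    qed
    then show "\<exists>K. finite K \<and> (\<forall>\<phi>. (\<forall>k\<in>K. blinfun_apply \<phi> k = 0) \<longrightarrow>
        \<psi> (dual_operator f \<phi>) \<le> e * norm \<phi>)"
      using K by blast
  qed (rule that)
  show "continuous_map weak_star_topology euclidean (\<lambda>\<phi>. \<psi> (dual_operator f \<phi>))"
    unfolding z by (rule strong_operator_topology_continuous_evaluation)
qed

section \<open>Surjectivity and the isomorphism\<close>
definition S_eval :: "'m::pointed_metric_space \<Rightarrow> ('m, 'x::real_normed_vector) S \<Rightarrow>\<^sub>L 'x" where
  "S_eval x = Blinfun (\<lambda>f. S_apply f x)"

lemma S_eval_apply [simp]:
  fixes f :: "('m::pointed_metric_space, 'x::real_normed_vector) S"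
  shows "blinfun_apply (S_eval x) f = S_apply f x"
proof -
  have "bounded_linear (\<lambda>f :: ('m, 'x) S. S_apply f x)"
  proof (rule bounded_linear_intro)
    show "norm (S_apply f x) \<le> norm f * dist x origin" for f :: "('m, 'x) S"
      using S_lipschitz[of f x origin] by (simp add: S_apply_origin)
  qed (simp_all add: plus_S.rep_eq scaleR_S.rep_eq)
  then show ?thesis
    by (simp add: S_eval_def bounded_linear_Blinfun_apply)
qed

text \<open>Followed by evaluation at \<open>x\<close>, the operator \<open>T\<close> becomes a weak-star continuous functional,
  which is the evaluation at some vector \<open>f x\<close>. A finite net of the relatively compact set
  \<open>T ` cball 0 1\<close> decays uniformly, so the functions \<open>T \<phi>\<close> with \<open>norm \<phi> \<le> 1\<close> decay uniformly as
  well, and taking a norming \<open>\<phi>\<close> transfers the decay to \<open>f\<close>.\<close>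
lemma dual_operator_surj:
  fixes T :: "('x::real_normed_vector \<Rightarrow>\<^sub>L real) \<Rightarrow>\<^sub>L ('m::pointed_metric_space, real) S"
  assumes T: "T \<in> K_wstar_w"
  obtains f where "dual_operator f = T"
proof -
  have "\<exists>z. \<forall>\<phi>. S_apply (T \<phi>) x = blinfun_apply \<phi> z" for x
  proof -
    have "continuous_map weak_star_topology euclidean (\<lambda>\<phi>. S_eval x (T \<phi>))"
      using T by (simp only: K_wstar_w_def mem_Collect_eq continuous_map_weak_topology_iff)
    moreover have "linear (\<lambda>\<phi>. S_eval x (T \<phi>))"
      by (intro linearI) (simp_all add: blinfun.add_right blinfun.scaleR_right
          plus_S.rep_eq scaleR_S.rep_eq)
    ultimately obtain z where "\<And>\<phi>. S_eval x (T \<phi>) = blinfun_apply \<phi> z"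
      using weak_star_continuous_functional by blast
    then show ?thesis by auto
  qed
  then have "\<exists>f. \<forall>x \<phi>. S_apply (T \<phi>) x = blinfun_apply \<phi> (f x)"
    by (intro choice) blast
  then obtain f where f: "\<And>x \<phi>. S_apply (T \<phi>) x = blinfun_apply \<phi> (f x)"
    by blast
  have diff_le: "norm (f x - f y) \<le> c"
    if slope: "\<And>\<phi>. norm \<phi> \<le> 1 \<Longrightarrow> \<bar>S_apply (T \<phi>) x - S_apply (T \<phi>) y\<bar> \<le> c" for x y c
  proof (rule norm_le_by_functionals)
    show "blinfun_apply \<phi> (f x - f y) \<le> c" if "norm \<phi> \<le> 1" for \<phi>
      using slope[OF that]
      by (simp add: f blinfun.diff_right)
  qed
  have "f \<in> S_set"
    unfolding S_set_iff
  proof (intro conjI allI impI)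
    have "f origin = 0"
      by (rule eq_by_functionals) (simp add: f[symmetric] S_apply_origin)
    moreover have "(norm T)-lipschitz_on UNIV f"
    proof (rule lipschitz_onI)
      fix x y
      show "dist (f x) (f y) \<le> norm T * dist x y"
        unfolding dist_norm[of "f x"]
      proof (rule diff_le)
        fix \<phi> :: "'x \<Rightarrow>\<^sub>L real" assume "norm \<phi> \<le> 1"
        have "norm (T \<phi>) \<le> norm T"
          using norm_blinfun[of T \<phi>] mult_left_mono[OF \<open>norm \<phi> \<le> 1\<close>, of "norm T"] by simp
        then have "norm (T \<phi>) * dist x y \<le> norm T * dist x y"
          by (rule mult_right_mono) simp
        then show "\<bar>S_apply (T \<phi>) x - S_apply (T \<phi>) y\<bar> \<le> norm T * dist x y"
          using S_lipschitz[of "T \<phi>" x y] by simp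
      qed
    qed simp
    ultimately show "f \<in> Lip"
      by (auto simp: Lip_def)
    fix e :: real assume "0 < e"
    have "compact (closure (T ` cball 0 1))"
      using T by (simp add: K_wstar_w_def compact_operator_def)
    then obtain \<G> where \<G>: "finite \<G>" "closure (T ` cball 0 1) \<subseteq> (\<Union>g\<in>\<G>. ball g (e / 2))"
      using compact_imp_seq_compact[THEN seq_compact_imp_totally_bounded] \<open>0 < e\<close>
      by (metis half_gt_zero)
    obtain \<delta> r where "0 < \<delta>" and decay: "\<And>g x y. g \<in> \<G> \<Longrightarrow>
        dist x y < \<delta> \<or> x \<notin> ball origin r \<or> y \<notin> ball origin r \<Longrightarrow>
        norm (S_apply g x - S_apply g y) \<le> e / 2 * dist x y"
      using S_decay_finite[OF \<G>(1) half_gt_zero[OF \<open>0 < e\<close>]] by blast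
    have "norm (f x - f y) \<le> e * dist x y"
      if xy: "dist x y < \<delta> \<or> x \<notin> ball origin r \<or> y \<notin> ball origin r" for x y
    proof (rule diff_le)
      fix \<phi> :: "'x \<Rightarrow>\<^sub>L real" assume "norm \<phi> \<le> 1"
      then have "T \<phi> \<in> closure (T ` cball 0 1)"
        by (intro subsetD[OF closure_subset]) auto
      then obtain g where "g \<in> \<G>" "norm (T \<phi> - g) < e / 2"
        using \<G>(2) by (force simp: dist_norm norm_minus_commute)
      have "\<bar>S_apply (T \<phi> - g) x - S_apply (T \<phi> - g) y\<bar> \<le> norm (T \<phi> - g) * dist x y"
        using S_lipschitz[of "T \<phi> - g" x y] by simp
      also have "\<dots> \<le> e / 2 * dist x y"
        using \<open>norm (T \<phi> - g) < e / 2\<close> by (intro mult_right_mono) auto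
      finally show "\<bar>S_apply (T \<phi>) x - S_apply (T \<phi>) y\<bar> \<le> e * dist x y"
        using decay[OF \<open>g \<in> \<G>\<close> xy] unfolding minus_S.rep_eq real_norm_def by linarith
    qed
    then show "\<exists>\<delta>>0. \<exists>r. \<forall>x y. dist x y < \<delta> \<or> x \<notin> ball origin r \<or> y \<notin> ball origin r \<longrightarrow>
        norm (f x - f y) \<le> e * dist x y"
      using \<open>0 < \<delta>\<close> by blast
  qed
  then have "dual_operator (Abs_S f) = T"
    by (intro blinfun_eqI S_eqI) (simp add: f Abs_S_inverse)
  then show ?thesis by (rule that)
qed

theorem theorem5p2:
  assumes "proper_metric TYPE('m::pointed_metric_space)"
  shows "\<exists>\<Phi> :: ('m, 'x::banach) S \<Rightarrow> (('x \<Rightarrow>\<^sub>L real) \<Rightarrow>\<^sub>L ('m, real) S).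
           linear \<Phi> \<and> (\<forall>f. norm (\<Phi> f) = norm f) \<and> bij_betw \<Phi> UNIV K_wstar_w"
proof (intro exI[of _ dual_operator] conjI allI)
  show "linear (dual_operator :: ('m, 'x) S \<Rightarrow> _)"
    by (rule linear_dual_operator)
  show "norm (dual_operator f) = norm f" for f :: "('m, 'x) S"
    by (rule norm_dual_operator)
  show "bij_betw (dual_operator :: ('m, 'x) S \<Rightarrow> _) UNIV K_wstar_w"
    unfolding bij_betw_def
  proof (intro conjI equalityI subsetI)
    show "inj (dual_operator :: ('m, 'x) S \<Rightarrow> _)"
      by (metis linear_dual_operator linear_injective_0 norm_dual_operator norm_eq_zero)
    show "T \<in> K_wstar_w" if "T \<in> range (dual_operator :: ('m, 'x) S \<Rightarrow> _)" for T
      using that compact_dual_operator[OF assms] dual_operator_weak_star_weak_continuous[OF assms]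
      by (auto simp: K_wstar_w_def)
    show "T \<in> range (dual_operator :: ('m, 'x) S \<Rightarrow> _)" if "T \<in> K_wstar_w" for T
      using dual_operator_surj[OF that] by blast
  qed
qed

end
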